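(* Let $G$ and $H$ be finite simple graphs which are homeomorphic, i.e. $G$ and $H$ can be equipped with graph topologies such that the resulting topological graphs $(G,\mathcal{B},\mathcal{O})$ and $(H,\mathcal{C},\mathcal{P})$ are homeomorphic. Then $G$ and $H$ have the same Euler characteristic: $\chi(G)=\chi(H)$.
   Context: All graphs are finite and simple. For a vertex $x$ of a graph $G=(V,E)$, the unit sphere $S(x)$ is the subgraph of $G$ generated (induced) by all vertices adjacent to $x$. The intersection of two subgraphs is the subgraph formed by their common vertices and common edges; a subgraph is also regarded as the set of its vertices when speaking of topologies on $V$. Dimension: $\dim(\emptyset)=-1$ and inductively $\dim(G)=\frac{1}{|V|}\sum_{x\in V}(1+\dim(S(x)))$. Euler characteristic: $\chi(G)=\sum_{k\ge 0}(-1)^k v_k$, where $v_k$ is the number of $K_{k+1}$ subgraphs of $G$. Homotopy: the one-point graph $K_1$ is contractible. A homotopy extension of a graph selects a contractible (induced) subgraph $H$ and adds a new vertex $z$ connected exactly to all vertices of $H$ (so $S(z)=H$). The reverse step removes a vertex $z$ with contractible unit sphere $S(z)$, together with all edges at $z$. Two graphs are homotopic if one can be obtained from the other by a finite sequence of such steps; a graph is contractible if it is homotopic to $K_1$. (This is an inductive definition.) Graph topology: two subgraphs $A,B$ satisfy the dimension assumption if $\dim(A\cap B)\ge \min(\dim(A),\dim(B))$, where the dimensions are those of these subgraphs as graphs themselves. A topology $\mathcal{O}$ on $V$ is a graph topology on $G=(V,E)$ if it has a sub-base $\mathcal{B}$ consisting of contractible subgraphs of $G$ such that (i) the intersection of any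 two elements of $\mathcal{B}$ satisfying the dimension assumption is contractible; (ii) every edge of $G$ is contained in some $B\in\mathcal{B}$; (iii) the nerve graph $\mathcal{G}=(\mathcal{B},\mathcal{E})$, whose vertices are the elements of $\mathcal{B}$ and whose edges are the pairs of distinct $A,B\in\mathcal{B}$ satisfying the dimension assumption, is homotopic to $G$. A graph with such a topology, written $(G,\mathcal{B},\mathcal{O})$, is a topological graph. Homeomorphism: given topological graphs $(G,\mathcal{B},\mathcal{O})$ and $(H,\mathcal{C},\mathcal{P})$ with nerve graphs $\mathcal{G},\mathcal{H}$, a map $\phi:\mathcal{O}\to\mathcal{P}$ is continuous if it induces a graph homomorphism $\mathcal{G}\to\mathcal{H}$ (it maps each $A\in\mathcal{B}$ to an element $\phi(A)\in\mathcal{C}$, edges of the nerve going to edges) such that $\dim(\phi(A))\le\dim(A)$ for every $A\in\mathcal{B}$. If $\phi$ has an inverse which is also continuous, $\phi$ is a graph homeomorphism and the topological graphs are homeomorphic. *)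

theory Defs
  imports "HOL-Analysis.Abstract_Topology"
begin

datatype 'a graph = Graph (verts: "'a set") (edges: "'a set set")

definition simple_graph :: "'a graph \<Rightarrow> bool" where
  "simple_graph G \<longleftrightarrow> finite (verts G) \<and> (\<forall>e\<in>edges G. e \<subseteq> verts G \<and> card e = 2)"

definition subgraph :: "'a graph \<Rightarrow> 'a graph \<Rightarrow> bool" where
  "subgraph A G \<longleftrightarrow> simple_graph A \<and> verts A \<subseteq> verts G \<and> edges A \<subseteq> edges G"

definition induced :: "'a graph \<Rightarrow> 'a set \<Rightarrow> 'a graph" where
  "induced G W = Graph (verts G \<inter> W) {e \<in> edges G. e \<subseteq> W}"

definition inter_graph :: "'a graph \<Rightarrow> 'a graph \<Rightarrow> 'a graph" where
  "inter_graph A B = Graph (verts A \<inter> verts B) (edges A \<inter> edges B)"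

definition unit_sphere :: "'a graph \<Rightarrow> 'a \<Rightarrow> 'a graph" where
  "unit_sphere G x = induced G {y. {x, y} \<in> edges G}"

definition complete_graph :: "nat \<Rightarrow> nat graph" where
  "complete_graph n = Graph {..<n} {e. e \<subseteq> {..<n} \<and> card e = 2}"

definition graph_hom :: "('a \<Rightarrow> 'b) \<Rightarrow> 'a graph \<Rightarrow> 'b graph \<Rightarrow> bool" where
  "graph_hom f G H \<longleftrightarrow> f ` verts G \<subseteq> verts H \<and> (\<forall>e\<in>edges G. f ` e \<in> edges H)"

definition isomorphic_graphs :: "'a graph \<Rightarrow> 'b graph \<Rightarrow> bool" where
  "isomorphic_graphs G H \<longleftrightarrow>
     (\<exists>f. bij_betw f (verts G) (verts H) \<and>
          (\<forall>x\<in>verts G. \<forall>y\<in>verts G. {x, y} \<in> edges G \<longleftrightarrow> {f x, f y} \<in> edges H))"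

lemma card_unit_sphere_less:
  assumes "simple_graph G" "x \<in> verts G"
  shows "card (verts (unit_sphere G x)) < card (verts G)"
proof (rule psubset_card_mono)
  show "finite (verts G)" using assms by (simp add: simple_graph_def)
  have "{x, x} \<notin> edges G" using assms by (force simp: simple_graph_def)
  then have "x \<notin> verts (unit_sphere G x)" "verts (unit_sphere G x) \<subseteq> verts G"
    by (simp_all add: unit_sphere_def induced_def)
  then show "verts (unit_sphere G x) \<subset> verts G" using assms(2) by blast
qed

declare sum.cong [fundef_cong]

text \<open>The value \<open>0\<close> outside finite simple graphs is a dummy that makes the function total.\<close>

function graph_dim :: "'a graph \<Rightarrow> real" where
  "graph_dim G =
     (if \<not> simple_graph G then 0
      else if verts G = {} then -1
      else (\<Sum>x\<in>verts G. 1 + graph_dim (unit_sphere G x)) / real (card (verts G)))"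
  by auto
termination
  by (relation "measure (card \<circ> verts)") (auto intro: card_unit_sphere_less)

declare graph_dim.simps [simp del]
declare sum.cong [fundef_cong del]

definition num_complete_subgraphs :: "'a graph \<Rightarrow> nat \<Rightarrow> nat" where
  "num_complete_subgraphs G n =
     card {K. subgraph K G \<and> isomorphic_graphs K (complete_graph n)}"

text \<open>A graph with \<open>n\<close> vertices has no complete subgraph on more than \<open>n\<close> vertices, so the
  alternating sum over all \<open>k \<ge> 0\<close> stops before \<open>k = n\<close>.\<close>

definition euler_char :: "'a graph \<Rightarrow> int" where
  "euler_char G =
     (\<Sum>k<card (verts G). (-1) ^ k * int (num_complete_subgraphs G (Suc k)))"

definition add_vertex :: "'a graph \<Rightarrow> 'a set \<Rightarrow> 'a \<Rightarrow> 'a graph" where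
  "add_vertex G W z = Graph (insert z (verts G)) (edges G \<union> {{z, w} | w. w \<in> W})"

definition remove_vertex :: "'a graph \<Rightarrow> 'a \<Rightarrow> 'a graph" where
  "remove_vertex G z = induced G (verts G - {z})"

text \<open>Homotopy steps are taken between graphs on natural numbers, so that there is always a new
  vertex available; other vertex types, possibly finite, are handled below up to isomorphism.
  A subgraph is contractible here if finitely many steps lead to it from a one-point graph
  \<open>Graph {x} {}\<close>; steps are reversible, so the direction does not matter.\<close>

inductive homotopy_step :: "nat graph \<Rightarrow> nat graph \<Rightarrow> bool" where
  extension: "homotopy_step G (add_vertex G W z)"
    if "simple_graph G" "W \<subseteq> verts G" "z \<notin> verts G"
       "homotopy_step\<^sup>*\<^sup>* (Graph {x} {}) (induced G W)"
| reduction: "homotopy_step G (remove_vertex G z)"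
    if "simple_graph G" "z \<in> verts G"
       "homotopy_step\<^sup>*\<^sup>* (Graph {x} {}) (unit_sphere G z)"

definition homotopic_graphs :: "'a graph \<Rightarrow> 'b graph \<Rightarrow> bool" where
  "homotopic_graphs G H \<longleftrightarrow>
     (\<exists>G' H'. isomorphic_graphs G G' \<and> isomorphic_graphs H H' \<and>
              simple_graph G' \<and> simple_graph H' \<and> homotopy_step\<^sup>*\<^sup>* G' H')"

definition contractible_graph :: "'a graph \<Rightarrow> bool" where
  "contractible_graph G \<longleftrightarrow> homotopic_graphs G (complete_graph 1)"

definition dimension_assumption :: "'a graph \<Rightarrow> 'a graph \<Rightarrow> bool" where
  "dimension_assumption A B \<longleftrightarrow>
     graph_dim (inter_graph A B) \<ge> min (graph_dim A) (graph_dim B)"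

definition nerve_graph :: "'a graph set \<Rightarrow> 'a graph graph" where
  "nerve_graph \<B> =
     Graph \<B> {{A, B} | A B. A \<in> \<B> \<and> B \<in> \<B> \<and> A \<noteq> B \<and> dimension_assumption A B}"

text \<open>\<open>relative_to V\<close> makes the empty intersection equal to \<open>V\<close>, so the sub-base is not
  required to cover \<open>V\<close>.\<close>

definition is_subbase :: "'a set set \<Rightarrow> 'a topology \<Rightarrow> bool" where
  "is_subbase \<S> T \<longleftrightarrow>
     openin T = arbitrary union_of (finite intersection_of (\<lambda>U. U \<in> \<S>) relative_to topspace T)"

definition topological_graph :: "'a graph \<Rightarrow> 'a graph set \<Rightarrow> 'a topology \<Rightarrow> bool" where
  "topological_graph G \<B> T \<longleftrightarrow>
     simple_graph G \<and>
     topspace T = verts G \<and>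
     is_subbase (verts ` \<B>) T \<and>
     (\<forall>A\<in>\<B>. subgraph A G \<and> contractible_graph A) \<and>
     (\<forall>A\<in>\<B>. \<forall>B\<in>\<B>. dimension_assumption A B \<longrightarrow> contractible_graph (inter_graph A B)) \<and>
     (\<forall>e\<in>edges G. \<exists>B\<in>\<B>. e \<in> edges B) \<and>
     homotopic_graphs (nerve_graph \<B>) G"

text \<open>A map \<open>\<phi>\<close> between the topologies acts on vertex sets, while the nerve has subgraphs as its
  vertices, and two members of the sub-base may share their vertex set. Hence the map \<open>f\<close> of
  subgraphs induced by \<open>\<phi>\<close> is a separate argument; if distinct members of the target sub-base
  have distinct vertex sets, \<open>f\<close> is determined by \<open>\<phi>\<close> on the source sub-base.\<close>

definition continuous_graph_map ::
    "'a graph set \<Rightarrow> 'a topology \<Rightarrow> 'b graph set \<Rightarrow> 'b topology \<Rightarrow>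
     ('a set \<Rightarrow> 'b set) \<Rightarrow> ('a graph \<Rightarrow> 'b graph) \<Rightarrow> bool" where
  "continuous_graph_map \<B> T \<C> P \<phi> f \<longleftrightarrow>
     (\<forall>U. openin T U \<longrightarrow> openin P (\<phi> U)) \<and>
     (\<forall>A\<in>\<B>. verts (f A) = \<phi> (verts A)) \<and>
     graph_hom f (nerve_graph \<B>) (nerve_graph \<C>) \<and>
     (\<forall>A\<in>\<B>. graph_dim (f A) \<le> graph_dim A)"

definition graph_homeomorphism ::
    "'a graph set \<Rightarrow> 'a topology \<Rightarrow> 'b graph set \<Rightarrow> 'b topology \<Rightarrow>
     ('a set \<Rightarrow> 'b set) \<Rightarrow> ('a graph \<Rightarrow> 'b graph) \<Rightarrow> bool" where
  "graph_homeomorphism \<B> T \<C> P \<phi> f \<longleftrightarrow>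
     continuous_graph_map \<B> T \<C> P \<phi> f \<and>
     (\<exists>\<psi> g. continuous_graph_map \<C> P \<B> T \<psi> g \<and>
        (\<forall>U. openin T U \<longrightarrow> \<psi> (\<phi> U) = U) \<and> (\<forall>U. openin P U \<longrightarrow> \<phi> (\<psi> U) = U) \<and>
        (\<forall>A\<in>\<B>. g (f A) = A) \<and> (\<forall>C\<in>\<C>. f (g C) = C))"

definition homeomorphic_graphs :: "'a graph \<Rightarrow> 'b graph \<Rightarrow> bool" where
  "homeomorphic_graphs G H \<longleftrightarrow>
     (\<exists>\<B> T \<C> P \<phi> f. topological_graph G \<B> T \<and> topological_graph H \<C> P \<and>
        graph_homeomorphism \<B> T \<C> P \<phi> f)"

end

theory Submission
  imports Defs
begin

text \<open>Homeomorphic topological graphs have isomorphic nerve graphs, and each nerve is homotopic to its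
  graph, so it suffices that the Euler characteristic is invariant under isomorphism and homotopy
  steps. With \<open>s G = (\<Sum>C. (-1) ^ card C)\<close> over all cliques \<open>C\<close>, including the empty one,
  \<open>euler_char G = 1 - s G\<close>. Splitting the cliques according to whether they contain
  a vertex \<open>z\<close> gives \<open>s G = s (G - z) - s (S z)\<close>, and \<open>s\<close> vanishes on contractible graphs.\<close>

section \<open>Cliques as vertex sets and their signed count\<close>

definition cliques :: "'a graph \<Rightarrow> 'a set set" where
  "cliques G = {W. W \<subseteq> verts G \<and> (\<forall>x\<in>W. \<forall>y\<in>W. x \<noteq> y \<longrightarrow> {x, y} \<in> edges G)}"

text \<open>For a finite graph this is minus the reduced Euler characteristic of its clique
  complex.\<close>

definition clique_sum :: "'a graph \<Rightarrow> int" where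
  "clique_sum G = (\<Sum>C\<in>cliques G. (-1) ^ card C)"

lemma cliques_subset_Pow: "cliques G \<subseteq> Pow (verts G)"
  by (auto simp: cliques_def)

lemma finite_cliques: "finite (verts G) \<Longrightarrow> finite (cliques G)"
  using cliques_subset_Pow by (rule finite_subset) simp

text \<open>Every bijection onto the vertices of a complete graph is an isomorphism as soon as all
  pairs of distinct vertices are adjacent, so the existential over maps reduces to a
  cardinality.\<close>

lemma isomorphic_complete_graph_iff:
  assumes "simple_graph K"
  shows "isomorphic_graphs K (complete_graph n) \<longleftrightarrow>
    card (verts K) = n \<and> (\<forall>x\<in>verts K. \<forall>y\<in>verts K. x \<noteq> y \<longrightarrow> {x, y} \<in> edges K)"
proof
  assume "isomorphic_graphs K (complete_graph n)"
  then obtain f where f: "bij_betw f (verts K) {..<n}"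
    and e: "\<forall>x\<in>verts K. \<forall>y\<in>verts K.
      {x, y} \<in> edges K \<longleftrightarrow> {f x, f y} \<subseteq> {..<n} \<and> card {f x, f y} = 2"
    by (auto simp: isomorphic_graphs_def complete_graph_def)
  have "{x, y} \<in> edges K" if "x \<in> verts K" "y \<in> verts K" "x \<noteq> y" for x y
  proof -
    have "f x \<noteq> f y" "f x < n" "f y < n"
      using that f by (auto simp: bij_betw_def inj_on_def)
    then show ?thesis using e that by auto
  qed
  then show "card (verts K) = n \<and> (\<forall>x\<in>verts K. \<forall>y\<in>verts K. x \<noteq> y \<longrightarrow> {x, y} \<in> edges K)"
    using bij_betw_same_card[OF f] by auto
next
  assume K: "card (verts K) = n \<and> (\<forall>x\<in>verts K. \<forall>y\<in>verts K. x \<noteq> y \<longrightarrow> {x, y} \<in> edges K)"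
  have "finite (verts K)" using assms by (simp add: simple_graph_def)
  then obtain f where f: "bij_betw f (verts K) {..<n}"
    using K by (metis card_lessThan finite_lessThan finite_same_card_bij)
  have "{x, y} \<in> edges K \<longleftrightarrow> {f x, f y} \<subseteq> {..<n} \<and> card {f x, f y} = 2"
    if "x \<in> verts K" "y \<in> verts K" for x y
  proof (cases "x = y")
    case True
    then have "{x, y} \<notin> edges K" using assms by (force simp: simple_graph_def)
    then show ?thesis using True by simp
  next
    case False
    have "f x \<noteq> f y" "f x < n" "f y < n"
      using that f False by (auto simp: bij_betw_def inj_on_def)
    then show ?thesis using K that False by auto
  qed
  then show "isomorphic_graphs K (complete_graph n)"
    using f by (auto simp: isomorphic_graphs_def complete_graph_def)
qed

text \<open>A complete simple graph is determined by its vertex set, since its edges must be all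
  two-element subsets. Hence \<open>verts\<close> is a bijection with inverse
  \<open>Graph W (?full W)\<close>.\<close>

lemma num_complete_subgraphs_eq:
  assumes "finite (verts G)"
  shows "num_complete_subgraphs G n = card {W \<in> cliques G. card W = n}"
proof -
  let ?full = "\<lambda>W. {e. e \<subseteq> W \<and> card e = 2}"
  have edges_eq: "edges K = ?full (verts K)"
    if "simple_graph K" "\<forall>x\<in>verts K. \<forall>y\<in>verts K. x \<noteq> y \<longrightarrow> {x, y} \<in> edges K" for K :: "'a graph"
    using that by (auto simp: simple_graph_def card_2_iff)
  have "bij_betw verts {K. subgraph K G \<and> isomorphic_graphs K (complete_graph n)}
      {W \<in> cliques G. card W = n}"
  proof (rule bij_betwI[where g = "\<lambda>W. Graph W (?full W)"])
    show "verts \<in> {K. subgraph K G \<and> isomorphic_graphs K (complete_graph n)}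
        \<rightarrow> {W \<in> cliques G. card W = n}"
      by (auto simp: subgraph_def isomorphic_complete_graph_iff cliques_def)
    have "subgraph (Graph W (?full W)) G \<and> isomorphic_graphs (Graph W (?full W)) (complete_graph n)"
      if W: "W \<in> cliques G" "card W = n" for W
    proof -
      have "simple_graph (Graph W (?full W))"
        using W(1) assms by (auto simp: simple_graph_def cliques_def intro: finite_subset)
      moreover from this have "isomorphic_graphs (Graph W (?full W)) (complete_graph n)"
        using W(2) by (auto simp: isomorphic_complete_graph_iff)
      moreover have "?full W \<subseteq> edges G" "W \<subseteq> verts G"
        using W(1) by (auto simp: cliques_def card_2_iff)
      ultimately show ?thesis by (simp add: subgraph_def)
    qed
    then show "(\<lambda>W. Graph W (?full W)) \<in> {W \<in> cliques G. card W = n}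
        \<rightarrow> {K. subgraph K G \<and> isomorphic_graphs K (complete_graph n)}"
      by blast
    show "Graph (verts K) (?full (verts K)) = K"
      if "K \<in> {K. subgraph K G \<and> isomorphic_graphs K (complete_graph n)}" for K
      using that edges_eq[of K]
      by (cases K) (auto simp: subgraph_def isomorphic_complete_graph_iff)
  qed simp
  then show ?thesis
    by (simp add: num_complete_subgraphs_def bij_betw_same_card)
qed

text \<open>Group the cliques by size. A complete subgraph on \<open>Suc k\<close> vertices has sign
  \<open>(-1) ^ k\<close> in \<open>euler_char\<close> but \<open>(-1) ^ Suc k\<close> here, which
  gives the minus; the empty clique gives the \<open>1\<close>.\<close>

lemma euler_char_eq_clique_sum:
  assumes "finite (verts G)"
  shows "euler_char G = 1 - clique_sum G"
proof -
  have fin: "finite (cliques G)" using assms by (rule finite_cliques)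
  have card_le: "card ` cliques G \<subseteq> {..card (verts G)}"
    using assms by (auto simp: cliques_def card_mono)
  have "clique_sum G = (\<Sum>n\<le>card (verts G). \<Sum>C | C \<in> cliques G \<and> card C = n. (-1) ^ card C)"
    unfolding clique_sum_def using fin card_le by (intro sum.group[symmetric]) auto
  also have "\<dots> = (\<Sum>n\<le>card (verts G). (-1) ^ n * int (num_complete_subgraphs G n))"
    using assms by (intro sum.cong) (auto simp: num_complete_subgraphs_eq)
  also have "\<dots> = int (num_complete_subgraphs G 0) - euler_char G"
    by (simp add: sum.atMost_shift euler_char_def sum_negf)
  also have "num_complete_subgraphs G 0 = card {{} :: 'a set}"
  proof -
    \<comment> \<open>\<open>card\<close> is \<open>0\<close> on infinite sets as well, so
      finiteness of \<open>verts G\<close> is what leaves only the empty clique.\<close>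
    have "{W \<in> cliques G. card W = 0} = {{}}"
      using assms by (auto simp: cliques_def dest: finite_subset)
    then show ?thesis using assms by (simp only: num_complete_subgraphs_eq)
  qed
  finally show ?thesis by simp
qed

section \<open>Invariance under isomorphism\<close>

lemma isomorphic_graphs_finite:
  "isomorphic_graphs G H \<Longrightarrow> finite (verts G) \<longleftrightarrow> finite (verts H)"
  by (auto simp: isomorphic_graphs_def bij_betw_finite)

text \<open>The vertex bijection acts on vertex sets by taking images; this restricts to a bijection
  between the cliques that preserves their size.\<close>

lemma clique_sum_isomorphic:
  assumes "isomorphic_graphs G H"
  shows "clique_sum G = clique_sum H"
proof -
  obtain f where f: "bij_betw f (verts G) (verts H)"
    and e: "\<And>x y. x \<in> verts G \<Longrightarrow> y \<in> verts G \<Longrightarrow> {x, y} \<in> edges G \<longleftrightarrow> {f x, f y} \<in> edges H"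
    using assms by (auto simp: isomorphic_graphs_def)
  have inj: "inj_on f (verts G)" and img: "f ` verts G = verts H"
    using f by (auto simp: bij_betw_def)
  have iff: "f ` W \<in> cliques H \<longleftrightarrow> W \<in> cliques G" if W: "W \<subseteq> verts G" for W
  proof -
    have "(f x \<noteq> f y \<longrightarrow> {f x, f y} \<in> edges H) \<longleftrightarrow> (x \<noteq> y \<longrightarrow> {x, y} \<in> edges G)"
      if "x \<in> W" "y \<in> W" for x y
      using that W e inj by (metis inj_onD subsetD)
    moreover have "f ` W \<subseteq> verts H" using W img by blast
    ultimately show ?thesis using W by (simp add: cliques_def)
  qed
  have "bij_betw ((`) f) (cliques G) (cliques H)"
  proof (rule bij_betw_imageI)
    show "inj_on ((`) f) (cliques G)"
      using inj_on_image_Pow[OF inj] cliques_subset_Pow by (rule inj_on_subset)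
    show "(`) f ` cliques G = cliques H"
    proof
      show "(`) f ` cliques G \<subseteq> cliques H"
        using iff cliques_subset_Pow by blast
      show "cliques H \<subseteq> (`) f ` cliques G"
      proof
        fix C assume C: "C \<in> cliques H"
        then have "C \<subseteq> f ` verts G" using img cliques_subset_Pow by blast
        then obtain W where "W \<subseteq> verts G" "C = f ` W" by (auto simp: subset_image_iff)
        then show "C \<in> (`) f ` cliques G" using iff C by blast
      qed
    qed
  qed
  then have "clique_sum H = (\<Sum>C\<in>cliques G. (-1) ^ card (f ` C))"
    unfolding clique_sum_def by (rule sum.reindex_bij_betw[symmetric])
  also have "\<dots> = clique_sum G"
    unfolding clique_sum_def
  proof (intro sum.cong refl)
    fix C assume "C \<in> cliques G"
    then have "inj_on f C" using inj cliques_subset_Pow by (blast intro: inj_on_subset)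
    then show "(-1) ^ card (f ` C) = ((-1) ^ card C :: int)" by (simp add: card_image)
  qed
  finally show ?thesis by simp
qed

lemma euler_char_isomorphic:
  assumes "isomorphic_graphs G H" "finite (verts G)"
  shows "euler_char G = euler_char H"
  using assms isomorphic_graphs_finite[OF assms(1)] clique_sum_isomorphic[OF assms(1)]
  by (simp add: euler_char_eq_clique_sum)

section \<open>Vertex deletion and homotopy steps\<close>

text \<open>Cliques avoiding \<open>z\<close> are those of the deletion. Cliques through
  \<open>z\<close> arise from cliques of the unit sphere by inserting \<open>z\<close>, and the
  extra vertex flips the sign.\<close>

lemma clique_sum_remove_vertex:
  assumes G: "simple_graph G" and z: "z \<in> verts G"
  shows "clique_sum G = clique_sum (remove_vertex G z) - clique_sum (unit_sphere G z)"
proof -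
  have fin: "finite (verts G)" using G by (simp add: simple_graph_def)
  let ?R = "cliques (remove_vertex G z)" and ?S = "cliques (unit_sphere G z)"
  \<comment> \<open>Without a loop at \<open>z\<close>, the unit sphere omits \<open>z\<close>; so
    \<open>insert z\<close> is injective on \<open>?S\<close> and raises each size by one.\<close>
  have "card {z, z} = 2" if "{z, z} \<in> edges G"
    using G that unfolding simple_graph_def by blast
  then have loop: "{z, z} \<notin> edges G" by auto
  have notin: "z \<notin> C" if "C \<in> ?S" for C
  proof -
    have "C \<subseteq> {y. {z, y} \<in> edges G}"
      using that by (auto simp: cliques_def unit_sphere_def induced_def)
    then show ?thesis using loop by blast
  qed
  have R: "?R = {C \<in> cliques G. z \<notin> C}"
    by (auto simp: cliques_def remove_vertex_def induced_def subset_iff)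
  have S: "insert z ` ?S = {C \<in> cliques G. z \<in> C}"
  proof (intro equalityI subsetI)
    fix C assume "C \<in> insert z ` ?S"
    then show "C \<in> {C \<in> cliques G. z \<in> C}"
      using z by (auto simp: cliques_def unit_sphere_def induced_def insert_commute)
  next
    fix C assume C: "C \<in> {C \<in> cliques G. z \<in> C}"
    then have "C - {z} \<in> ?S"
      by (auto simp: cliques_def unit_sphere_def induced_def)
    then show "C \<in> insert z ` ?S" using C by (auto intro: image_eqI[of _ _ "C - {z}"])
  qed
  have finS: "finite C" if "C \<in> ?S" for C
    using that fin by (auto simp: cliques_def unit_sphere_def induced_def dest: finite_subset)
  have "inj_on (insert z) ?S"
    using notin by (metis Diff_insert_absorb inj_onI)
  then have "(\<Sum>C\<in>insert z ` ?S. (-1) ^ card C) = (\<Sum>C\<in>?S. (-1) ^ card (insert z C) :: int)"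
    by (simp add: sum.reindex)
  also have "\<dots> = - clique_sum (unit_sphere G z)"
    using notin finS by (simp add: clique_sum_def sum_negf)
  finally have "(\<Sum>C | C \<in> cliques G \<and> z \<in> C. (-1) ^ card C) = - clique_sum (unit_sphere G z)"
    by (simp only: S)
  moreover have "clique_sum G = (\<Sum>C\<in>{C \<in> cliques G. z \<notin> C} \<union> {C \<in> cliques G. z \<in> C}. (-1) ^ card C)"
    unfolding clique_sum_def by (rule sum.cong) auto
  then have "clique_sum G = (\<Sum>C | C \<in> cliques G \<and> z \<notin> C. (-1) ^ card C)
      + (\<Sum>C | C \<in> cliques G \<and> z \<in> C. (-1) ^ card C)"
    using finite_cliques[OF fin] by (subst (asm) sum.union_disjoint) auto
  ultimately show ?thesis by (simp add: clique_sum_def R)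
qed

text \<open>The empty clique and the vertex cancel; this starts the vanishing on contractible
  graphs.\<close>

lemma clique_sum_singleton: "clique_sum (Graph {x} {}) = 0"
proof -
  have "cliques (Graph {x} {}) = {{}, {x}}" by (auto simp: cliques_def)
  then show ?thesis by (simp add: clique_sum_def)
qed

text \<open>An extension is undone by deleting the new vertex, so the deletion formula covers both
  kinds of homotopy step.\<close>

lemma
  assumes "simple_graph G" "W \<subseteq> verts G" "z \<notin> verts G"
  shows simple_graph_add_vertex: "simple_graph (add_vertex G W z)"
    and remove_vertex_add_vertex: "remove_vertex (add_vertex G W z) z = G"
    and unit_sphere_add_vertex: "unit_sphere (add_vertex G W z) z = induced G W"
proof -
  have notin: "z \<notin> e" if "e \<in> edges G" for e
    using that assms by (auto simp: simple_graph_def)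
  have sub: "e \<subseteq> verts G" if "e \<in> edges G" for e
    using that assms by (auto simp: simple_graph_def)
  show "simple_graph (add_vertex G W z)"
    using assms by (auto simp: simple_graph_def add_vertex_def card_insert_if)
  show "remove_vertex (add_vertex G W z) z = G"
    using assms(3) notin sub
    by (cases G) (fastforce simp: remove_vertex_def add_vertex_def induced_def)
  have "{y. {z, y} \<in> edges (add_vertex G W z)} = W"
    using assms notin by (auto simp: add_vertex_def doubleton_eq_iff)
  then show "unit_sphere (add_vertex G W z) z = induced G W"
    using assms by (auto simp: unit_sphere_def add_vertex_def induced_def)
qed

text \<open>The sphere term of the deletion formula vanishes, because the sphere is joined to a
  one-point graph by a chain of steps to which the induction hypothesis applies.\<close>

lemma clique_sum_homotopy_step:
  "homotopy_step G H \<Longrightarrow> clique_sum G = clique_sum H"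
proof (induction rule: homotopy_step.induct)
  case (extension G W z x)
  \<comment> \<open>Rule induction pairs every step of the chain in this premise with the equality
    of its clique sums, so the value is constant along the chain.\<close>
  have "clique_sum (Graph {x} {}) = clique_sum (induced G W)"
    using extension(4) by (induction rule: rtranclp_induct) auto
  then show ?case
    \<comment> \<open>The deletion formula is applied to the larger graph, where deleting
      \<open>z\<close> returns \<open>G\<close> and the sphere is
      \<open>induced G W\<close>.\<close>
    using extension(1-3) clique_sum_remove_vertex[of "add_vertex G W z" z]
    by (simp add: simple_graph_add_vertex remove_vertex_add_vertex unit_sphere_add_vertex
        clique_sum_singleton) (simp add: add_vertex_def)
next
  case (reduction G z x)
  have "clique_sum (Graph {x} {}) = clique_sum (unit_sphere G z)"
    using reduction(3) by (induction rule: rtranclp_induct) auto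
  then show ?case
    using reduction(1,2) clique_sum_remove_vertex[of G z] by (simp add: clique_sum_singleton)
qed

lemma euler_char_homotopic:
  assumes "homotopic_graphs G H"
  shows "euler_char G = euler_char H"
proof -
  obtain G' H' where iso: "isomorphic_graphs G G'" "isomorphic_graphs H H'"
    and fin: "finite (verts G')" "finite (verts H')" and steps: "homotopy_step\<^sup>*\<^sup>* G' H'"
    using assms by (auto simp: homotopic_graphs_def simple_graph_def)
  have "clique_sum G' = clique_sum H'"
    using steps by (induction rule: rtranclp_induct) (auto dest: clique_sum_homotopy_step)
  then have "euler_char G' = euler_char H'"
    using fin by (simp add: euler_char_eq_clique_sum)
  moreover have "euler_char G = euler_char G'" "euler_char H = euler_char H'"
    using iso fin by (metis euler_char_isomorphic isomorphic_graphs_finite)+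
  ultimately show ?thesis by simp
qed

section \<open>From homeomorphisms to isomorphic nerves\<close>

text \<open>Supplies finiteness of the nerve: it has an isomorphic copy that is a simple graph on
  natural numbers.\<close>

lemma homotopic_graphs_finite: "homotopic_graphs G H \<Longrightarrow> finite (verts G)"
  unfolding homotopic_graphs_def simple_graph_def using isomorphic_graphs_finite by blast

text \<open>A bijective homomorphism may fail to reflect edges; here the inverse being a
  homomorphism gives the reflection.\<close>

lemma isomorphic_graphsI_inverse_homs:
  assumes f: "graph_hom f G H" and g: "graph_hom g H G"
    and gf: "\<And>x. x \<in> verts G \<Longrightarrow> g (f x) = x" and fg: "\<And>y. y \<in> verts H \<Longrightarrow> f (g y) = y"
  shows "isomorphic_graphs G H"
proof -
  have "bij_betw f (verts G) (verts H)"
    using assms by (intro bij_betwI[where g = g]) (auto simp: graph_hom_def)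
  moreover have "{x, y} \<in> edges G \<longleftrightarrow> {f x, f y} \<in> edges H"
    if "x \<in> verts G" "y \<in> verts G" for x y
  proof
    assume "{x, y} \<in> edges G"
    then have "f ` {x, y} \<in> edges H" using f unfolding graph_hom_def by blast
    then show "{f x, f y} \<in> edges H" by simp
  next
    assume "{f x, f y} \<in> edges H"
    then have "g ` {f x, f y} \<in> edges G" using g unfolding graph_hom_def by blast
    then show "{x, y} \<in> edges G" using gf that by simp
  qed
  ultimately show ?thesis unfolding isomorphic_graphs_def by blast
qed

theorem theorem5:
  fixes G :: "'a graph" and H :: "'b graph"
  assumes "simple_graph G" and "simple_graph H"
    and "homeomorphic_graphs G H"
  shows "euler_char G = euler_char H"
proof -
  obtain \<B> T \<C> P \<phi> f where B: "topological_graph G \<B> T" and C: "topological_graph H \<C> P"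
    and hom: "graph_homeomorphism \<B> T \<C> P \<phi> f"
    using assms(3) unfolding homeomorphic_graphs_def by blast
  have nerve_B: "homotopic_graphs (nerve_graph \<B>) G"
    using B unfolding topological_graph_def by (elim conjE)
  have nerve_C: "homotopic_graphs (nerve_graph \<C>) H"
    using C unfolding topological_graph_def by (elim conjE)
  \<comment> \<open>The members of the sub-bases are the vertices of the nerves, so \<open>f\<close>
    and \<open>g\<close> are mutually inverse homomorphisms between the nerves.\<close>
  obtain g where "graph_hom f (nerve_graph \<B>) (nerve_graph \<C>)"
    "graph_hom g (nerve_graph \<C>) (nerve_graph \<B>)"
    and "\<forall>A\<in>\<B>. g (f A) = A" "\<forall>C\<in>\<C>. f (g C) = C"
    using hom unfolding graph_homeomorphism_def continuous_graph_map_def by (elim conjE exE) (rule that)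
  moreover have "verts (nerve_graph \<B>) = \<B>" "verts (nerve_graph \<C>) = \<C>"
    by (simp_all add: nerve_graph_def)
  ultimately have "isomorphic_graphs (nerve_graph \<B>) (nerve_graph \<C>)"
    by (metis isomorphic_graphsI_inverse_homs)
  then have "euler_char (nerve_graph \<B>) = euler_char (nerve_graph \<C>)"
    using homotopic_graphs_finite[OF nerve_B] by (rule euler_char_isomorphic)
  then show ?thesis
    using euler_char_homotopic[OF nerve_B] euler_char_homotopic[OF nerve_C] by simp
qed

end
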